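(* Let $G$ be a locally finite group, $\phi:G\to G$ a group endomorphism and $F$ a finite normal subgroup of $G$ such that $\ker\phi\cap T(\phi,F)$ is finite. Then $$H_{alg}(\phi,F)=\log\left|\frac{T(\phi,F)}{\phi(T(\phi,F))}\right|-\log|\ker\phi\cap T(\phi,F)|.$$
   Context: Groups here are discrete. A group is locally finite if each of its finitely generated subgroups is finite. For a finite subgroup $F$ of $G$ and a positive integer $n$, the $n$-th $\phi$-trajectory of $F$ is the product set $T_n(\phi,F)=F\cdot\phi(F)\cdot\ldots\cdot\phi^{n-1}(F)$, and the $\phi$-trajectory of $F$ is $T(\phi,F)=\bigcup_{n=1}^\infty T_n(\phi,F)$. (When $F$ is normal in $G$, these are subgroups of $G$, and $\phi(T(\phi,F))\subseteq T(\phi,F)$.) The algebraic entropy of $\phi$ with respect to $F$ is the limit (known to exist) $H_{alg}(\phi,F)=\lim_{n\to\infty}\frac{\log|T_n(\phi,F)|}{n}$. For a subgroup $B$ of a group $A$, $|A/B|$ denotes the index $[A:B]$ (the number of cosets; $B$ is not required to be normal). *)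

theory Defs
  imports Complex_Main "HOL-Algebra.Coset" "HOL-Algebra.Generated_Groups"
begin

definition finitely_generated_subgroup :: "('a, 'b) monoid_scheme \<Rightarrow> 'a set \<Rightarrow> bool" where
  "finitely_generated_subgroup G H \<longleftrightarrow>
     (\<exists>S. finite S \<and> S \<subseteq> carrier G \<and> H = generate G S)"

definition locally_finite_group :: "('a, 'b) monoid_scheme \<Rightarrow> bool" where
  "locally_finite_group G \<longleftrightarrow>
     group G \<and> (\<forall>H. finitely_generated_subgroup G H \<longrightarrow> finite H)"

text \<open>The partial trajectory \<open>F \<cdot> \<phi>(F) \<cdot> \<dots> \<cdot> \<phi>\<^sup>n\<^sup>-\<^sup>1(F)\<close>;
  the value at \<open>0\<close> is the empty product.\<close>

primrec traj_upto ::
    "('a, 'b) monoid_scheme \<Rightarrow> ('a \<Rightarrow> 'a) \<Rightarrow> 'a set \<Rightarrow> nat \<Rightarrow> 'a set" where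
  "traj_upto G \<phi> F 0 = {\<one>\<^bsub>G\<^esub>}"
| "traj_upto G \<phi> F (Suc n) = traj_upto G \<phi> F n <#>\<^bsub>G\<^esub> ((\<phi> ^^ n) ` F)"

definition trajectory ::
    "('a, 'b) monoid_scheme \<Rightarrow> ('a \<Rightarrow> 'a) \<Rightarrow> 'a set \<Rightarrow> 'a set" where
  "trajectory G \<phi> F = (\<Union>n\<in>{1..}. traj_upto G \<phi> F n)"

definition alg_entropy ::
    "('a, 'b) monoid_scheme \<Rightarrow> ('a \<Rightarrow> 'a) \<Rightarrow> 'a set \<Rightarrow> real" where
  "alg_entropy G \<phi> F = lim (\<lambda>n. ln (real (card (traj_upto G \<phi> F n))) / real n)"

text \<open>\<open>cosets_in G A B\<close> is \<open>A/B\<close> for a subgroup \<open>B\<close> of a subgroup \<open>A\<close> of \<open>G\<close>. It is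
  the set of right cosets; inversion gives a bijection with the left cosets, so the choice
  does not affect the index.\<close>

definition cosets_in :: "('a, 'b) monoid_scheme \<Rightarrow> 'a set \<Rightarrow> 'a set \<Rightarrow> 'a set set" where
  "cosets_in G A B = rcosets\<^bsub>G\<lparr>carrier := A\<rparr>\<^esub> B"

end

theory Submission
  imports Defs "HOL-Algebra.Zassenhaus"
begin

text \<open>
  Write \<open>T\<^sub>n\<close> and \<open>T\<close> for the partial and the full trajectory, \<open>K = ker \<phi> \<inter> T\<close>, and
  \<open>c = |T / \<phi>(T)|\<close>. The idea is that the sizes \<open>|T\<^sub>n|\<close> eventually form a geometric
  progression with ratio \<open>c / |K|\<close>, so that \<open>ln |T\<^sub>n| / n\<close> converges to \<open>ln c - ln |K|\<close>.

  The trajectory can be peeled at the left end: \<open>T\<^sub>n\<^sub>+\<^sub>1 = F \<cdot> \<phi>(T\<^sub>n)\<close> and \<open>T = F \<cdot> \<phi>(T)\<close>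
  (\<open>traj_upto_Suc_left\<close>, \<open>trajectory_left\<close>). Since \<open>F\<close> is normal, the first equation shows
  inductively that all \<open>T\<^sub>n\<close> are subgroups, although the sets \<open>\<phi>\<^sup>i(F)\<close> need not be normal.
  The two equations have the shape \<open>F \<cdot> H\<close> with \<open>H = \<phi>(T\<^sub>n)\<close> or \<open>H = \<phi>(T)\<close>, and the index of
  \<open>H\<close> in \<open>F \<cdot> H\<close> is \<open>|F| / |H \<inter> F|\<close> (\<open>card_cosets_in_normal_mult\<close>), so it depends
  on \<open>H\<close> only through its trace on the finite group \<open>F\<close>.

  The \<open>T\<^sub>n\<close> increase to \<open>T\<close>, so finite subsets of \<open>T\<close> and of \<open>\<phi>(T)\<close> are already contained
  in \<open>T\<^sub>n\<close> and \<open>\<phi>(T\<^sub>n)\<close> for large \<open>n\<close>. For such \<open>n\<close> we have \<open>\<phi>(T\<^sub>n) \<inter> F = \<phi>(T) \<inter> F\<close>, hence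
  \<open>\<phi>(T\<^sub>n)\<close> has index \<open>c\<close> in \<open>T\<^sub>n\<^sub>+\<^sub>1\<close>; and \<open>K \<subseteq> T\<^sub>n\<close>, hence \<open>\<phi>\<close> divides the size of \<open>T\<^sub>n\<close>
  by \<open>|K|\<close>. Together these give \<open>|T\<^sub>n\<^sub>+\<^sub>1| \<cdot> |K| = c \<cdot> |T\<^sub>n|\<close>.
\<close>

section \<open>Counting cosets and fibres\<close>

text \<open>
  The fibres of \<open>f\<close> on \<open>A\<close> are translates of \<open>N \<inter> A\<close>. With \<open>f\<close> a homomorphism and \<open>N\<close> its
  kernel this is the isomorphism theorem in numbers; with \<open>f\<close> the map \<open>x \<mapsto> Nx\<close> it counts the
  cosets of \<open>N\<close> that meet \<open>A\<close>.
\<close>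

lemma (in group) card_image_mult_card_fibre:
  assumes A: "subgroup A G" and fin: "finite A"
    and fibre: "\<And>x y. x \<in> A \<Longrightarrow> y \<in> A \<Longrightarrow> f x = f y \<longleftrightarrow> x \<otimes> inv y \<in> N"
  shows "card (f ` A) * card (N \<inter> A) = card A"
proof -
  have car: "x \<in> carrier G" if "x \<in> A" for x
    using subgroup.mem_carrier[OF A that] .
  have "card {x \<in> A. f x = f a} = card (N \<inter> A)" if a: "a \<in> A" for a
  proof -
    have "bij_betw (\<lambda>h. h \<otimes> a) (N \<inter> A) {x \<in> A. f x = f a}"
    proof (rule bij_betw_byWitness[where f' = "\<lambda>x. x \<otimes> inv a"])
      show "(\<lambda>h. h \<otimes> a) ` (N \<inter> A) \<subseteq> {x \<in> A. f x = f a}"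
        using a A car by (auto simp: fibre subgroup.m_closed m_assoc)
      show "(\<lambda>x. x \<otimes> inv a) ` {x \<in> A. f x = f a} \<subseteq> N \<inter> A"
        using a A by (auto simp: fibre subgroup.m_closed subgroup.m_inv_closed)
    qed (use a car in \<open>auto simp: m_assoc\<close>)
    then show ?thesis by (metis bij_betw_same_card)
  qed
  then have "(\<Sum>y\<in>f ` A. card {x \<in> A. f x = y}) = (\<Sum>y\<in>f ` A. card (N \<inter> A))"
    by (intro sum.cong) auto
  then show ?thesis
    using sum.image_gen[OF fin, of "\<lambda>_. 1::nat" f] by simp
qed

lemma (in group_hom) hom_eq_iff_kernel:
  assumes "x \<in> carrier G" "y \<in> carrier G"
  shows "h x = h y \<longleftrightarrow> x \<otimes> inv y \<in> kernel G H h"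
proof
  assume "h x = h y"
  then show "x \<otimes> inv y \<in> kernel G H h" using assms by (simp add: kernel_def)
next
  assume "x \<otimes> inv y \<in> kernel G H h"
  then have "h x \<otimes>\<^bsub>H\<^esub> inv\<^bsub>H\<^esub> h y = \<one>\<^bsub>H\<^esub>" using assms by (simp add: kernel_def)
  then have "inv\<^bsub>H\<^esub> (inv\<^bsub>H\<^esub> h y) = h x" using assms by (intro H.inv_equality) simp_all
  then show "h x = h y" using assms by simp
qed

lemma (in group) finite_set_mult:
  "finite A \<Longrightarrow> finite B \<Longrightarrow> finite (A <#> B)"
  unfolding set_mult_def by auto

text \<open>Since \<open>hx\<close> and \<open>x\<close> lie in the same right coset of \<open>H\<close>, every coset of \<open>H\<close> in the set
  \<open>H \<cdot> F\<close> has a representative in \<open>F\<close>.\<close>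

lemma (in group) cosets_in_set_mult:
  assumes H: "subgroup H G" and F: "F \<subseteq> carrier G"
  shows "cosets_in G (H <#> F) H = (\<lambda>x. H #> x) ` F"
proof -
  have coset: "H #> (h \<otimes> x) = H #> x" if "h \<in> H" "x \<in> F" for h x
    using that H F coset_mult_assoc[of H h x] subgroup.rcos_const[OF H is_group, of h]
    by (auto simp: subgroup.subset subgroup.mem_carrier)
  have "cosets_in G (H <#> F) H = (\<lambda>x. H #> x) ` (H <#> F)"
    by (auto simp: cosets_in_def RCOSETS_def r_coset_def)
  also have "\<dots> = (\<Union>h\<in>H. (\<lambda>x. H #> (h \<otimes> x)) ` F)"
    by (auto simp: set_mult_def)
  also have "\<dots> = (\<lambda>x. H #> x) ` F"
    using coset subgroup.one_closed[OF H] by auto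
  finally show ?thesis .
qed

text \<open>Normality of \<open>F\<close> turns \<open>F \<cdot> H\<close> into \<open>H \<cdot> F\<close>, so the right cosets of \<open>H\<close> are represented
  by \<open>F\<close>, and two elements of \<open>F\<close> represent the same one when they agree modulo \<open>H \<inter> F\<close>. For
  \<open>H = \<phi>(T)\<close>, which may be infinite, this is what makes the index finite.\<close>

lemma (in group) card_cosets_in_normal_mult:
  assumes H: "subgroup H G" and F: "F \<lhd> G" and fin: "finite F"
  shows "finite (cosets_in G (F <#> H) H)"
    and "card (cosets_in G (F <#> H) H) * card (H \<inter> F) = card F"
proof -
  have sF: "subgroup F G" using F by (rule normal_imp_subgroup)
  have eq: "cosets_in G (F <#> H) H = (\<lambda>x. H #> x) ` F"
    using commut_normal[OF H F] cosets_in_set_mult[OF H subgroup.subset[OF sF]] by simp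
  show "finite (cosets_in G (F <#> H) H)" using eq fin by simp
  have "H #> x = H #> y \<longleftrightarrow> x \<otimes> inv y \<in> H" if "x \<in> F" "y \<in> F" for x y
  proof -
    have c: "x \<in> carrier G" "y \<in> carrier G"
      using that sF by (auto simp: subgroup.mem_carrier)
    have "H #> x = H #> y \<longleftrightarrow> x \<in> H #> y"
      using repr_independence[OF _ _ H] rcos_self[OF _ H] c by blast
    then show ?thesis
      using subgroup.rcos_module[OF H is_group] c by simp
  qed
  then show "card (cosets_in G (F <#> H) H) * card (H \<inter> F) = card F"
    unfolding eq using card_image_mult_card_fibre[OF sF fin] by blast
qed

lemma (in group) card_cosets_in:
  assumes A: "subgroup A G" and H: "subgroup H G" and "H \<subseteq> A"
  shows "card (cosets_in G A H) * card H = card A"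
proof -
  have "group (G\<lparr>carrier := A\<rparr>)" by (rule subgroup_imp_group[OF A])
  moreover have "subgroup H (G\<lparr>carrier := A\<rparr>)"
    using subgroup_incl[OF H A \<open>H \<subseteq> A\<close>] .
  ultimately show ?thesis
    using group.lagrange[of "G\<lparr>carrier := A\<rparr>" H] by (simp add: cosets_in_def order_def)
qed

section \<open>Increasing unions and eventually geometric sequences\<close>

lemma finite_subset_incseq_Union:
  fixes A :: "nat \<Rightarrow> 'a set"
  assumes "incseq A" and "finite X" and "X \<subseteq> (\<Union>n. A n)"
  shows "\<forall>\<^sub>F n in sequentially. X \<subseteq> A n"
proof -
  have "\<forall>\<^sub>F n in sequentially. x \<in> A n" if x: "x \<in> X" for x
  proof -
    obtain m where "x \<in> A m" using x assms(3) by auto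
    then have "\<forall>n\<ge>m. x \<in> A n" using incseqD[OF assms(1)] by blast
    then show ?thesis by (auto simp: eventually_sequentially)
  qed
  then have "\<forall>\<^sub>F n in sequentially. \<forall>x\<in>X. x \<in> A n"
    by (intro eventually_ball_finite[OF assms(2)] ballI)
  then show ?thesis by (simp only: subset_eq)
qed

lemma tendsto_div_of_eventually_const_diff:
  fixes a :: "nat \<Rightarrow> real"
  assumes "\<forall>\<^sub>F n in sequentially. a (Suc n) = a n + d"
  shows "(\<lambda>n. a n / real n) \<longlonglongrightarrow> d"
proof -
  obtain N where N: "a (Suc n) = a n + d" if "n \<ge> N" for n
    using assms by (auto simp: eventually_sequentially)
  have a: "a n = a N + (real n - real N) * d" if "n \<ge> N" for n
    using that by (induction n rule: dec_induct) (auto simp: N algebra_simps)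
  have "(\<lambda>n. (a N - real N * d) / real n + d) \<longlonglongrightarrow> 0 + d"
    by (intro tendsto_intros lim_const_over_n)
  moreover have "\<forall>\<^sub>F n in sequentially. (a N - real N * d) / real n + d = a n / real n"
    using eventually_ge_at_top[of "max N 1"]
  proof eventually_elim
    case (elim n)
    then show ?case using a[of n] by (simp add: field_simps)
  qed
  ultimately show ?thesis by (simp add: tendsto_cong)
qed

section \<open>Trajectories\<close>

context
  fixes G :: "('a, 'b) monoid_scheme" (structure) and \<phi> :: "'a \<Rightarrow> 'a" and F :: "'a set"
  assumes G: "group G" and hom: "\<phi> \<in> hom G G" and F: "F \<lhd> G"
begin

interpretation group G by (rule G)

interpretation group_hom G G \<phi>
  using hom by (unfold_locales)

lemma funpow_image_subgroup: "subgroup ((\<phi> ^^ n) ` F) G"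
proof (induction n)
  case 0
  then show ?case using normal_imp_subgroup[OF F] by simp
next
  case (Suc n)
  then show ?case using subgroup_img_is_subgroup[OF Suc] by (simp add: image_comp)
qed

lemma traj_upto_subset_carrier: "traj_upto G \<phi> F n \<subseteq> carrier G"
proof (induction n)
  case (Suc n)
  then show ?case
    using setmult_subset_G[OF Suc subgroup.subset[OF funpow_image_subgroup]] by simp
qed simp

text \<open>The definition multiplies by a new factor on the right; associativity lets the factor \<open>F\<close>
  be split off on the left instead, which exhibits all other factors as an image under \<open>\<phi>\<close>.\<close>

lemma traj_upto_Suc_left: "traj_upto G \<phi> F (Suc n) = F <#> \<phi> ` traj_upto G \<phi> F n"
proof (induction n)
  case 0
  have "F \<subseteq> carrier G" using normal_imp_subgroup[OF F] by (rule subgroup.subset)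
  then have "F <#> {\<one>} = F" "{\<one>} <#> F = F"
    by (force simp: set_mult_def)+
  then show ?case by simp
next
  case (Suc n)
  let ?T = "traj_upto G \<phi> F n" and ?S = "(\<phi> ^^ n) ` F"
  have sub: "F \<subseteq> carrier G" "\<phi> ` ?T \<subseteq> carrier G" "\<phi> ` ?S \<subseteq> carrier G"
    using subsetD[OF subgroup.subset[OF funpow_image_subgroup]]
      subsetD[OF traj_upto_subset_carrier] subgroup.subset[OF normal_imp_subgroup[OF F]]
    by (blast intro: hom_closed)+
  have "traj_upto G \<phi> F (Suc (Suc n)) = (F <#> \<phi> ` ?T) <#> \<phi> ` ?S"
    using Suc by (simp add: image_comp)
  also have "\<dots> = F <#> (\<phi> ` ?T <#> \<phi> ` ?S)"
    by (rule set_mult_assoc[OF sub])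
  also have "\<phi> ` ?T <#> \<phi> ` ?S = \<phi> ` traj_upto G \<phi> F (Suc n)"
    using set_mult_hom[OF hom traj_upto_subset_carrier
        subgroup.subset[OF funpow_image_subgroup]] by simp
  finally show ?case .
qed

lemma subgroup_traj_upto: "subgroup (traj_upto G \<phi> F n) G"
proof (induction n)
  case 0
  show ?case by (simp add: triv_subgroup)
next
  case (Suc n)
  then show ?case
    unfolding traj_upto_Suc_left
    by (intro mult_norm_subgroup F subgroup_img_is_subgroup)
qed

lemma incseq_traj_upto: "incseq (traj_upto G \<phi> F)"
proof (rule incseq_SucI)
  fix n
  show "traj_upto G \<phi> F n \<subseteq> traj_upto G \<phi> F (Suc n)"
  proof
    fix x assume x: "x \<in> traj_upto G \<phi> F n"
    then have "x = x \<otimes> \<one>" using subsetD[OF traj_upto_subset_carrier] by simp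
    moreover have "\<one> \<in> (\<phi> ^^ n) ` F" using subgroup.one_closed[OF funpow_image_subgroup] .
    ultimately show "x \<in> traj_upto G \<phi> F (Suc n)"
      using x unfolding traj_upto.simps set_mult_def by blast
  qed
qed

text \<open>The trivial \<open>T\<^sub>0 = {\<one>}\<close> may join the union, as it lies in \<open>T\<^sub>1\<close>. With it,
  \<open>T\<^sub>n\<^sub>+\<^sub>1 = F \<cdot> \<phi>(T\<^sub>n)\<close> turns the union over all indices into the one over positive indices.\<close>

lemma trajectory_eq_Union: "trajectory G \<phi> F = (\<Union>n. traj_upto G \<phi> F n)"
proof -
  have "traj_upto G \<phi> F n \<subseteq> traj_upto G \<phi> F (Suc n)" for n
    using incseq_SucD[OF incseq_traj_upto] .
  then show ?thesis unfolding trajectory_def by force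
qed

lemma trajectory_left: "trajectory G \<phi> F = F <#> \<phi> ` trajectory G \<phi> F"
proof -
  have "trajectory G \<phi> F = (\<Union>n. traj_upto G \<phi> F (Suc n))"
    unfolding trajectory_def by (auto simp del: traj_upto.simps) (metis Suc_le_D)
  also have "\<dots> = F <#> \<phi> ` (\<Union>n. traj_upto G \<phi> F n)"
    unfolding traj_upto_Suc_left by (auto simp: set_mult_def)
  finally show ?thesis by (simp add: trajectory_eq_Union)
qed

lemma subgroup_trajectory: "subgroup (trajectory G \<phi> F) G"
proof (rule subgroupI)
  show "trajectory G \<phi> F \<subseteq> carrier G"
    using traj_upto_subset_carrier by (auto simp: trajectory_eq_Union)
  show "trajectory G \<phi> F \<noteq> {}"
    using subgroup.one_closed[OF subgroup_traj_upto] by (force simp: trajectory_eq_Union)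
  show "inv x \<in> trajectory G \<phi> F" if "x \<in> trajectory G \<phi> F" for x
    using that subgroup.m_inv_closed[OF subgroup_traj_upto]
    by (auto simp: trajectory_eq_Union)
  show "x \<otimes> y \<in> trajectory G \<phi> F"
    if "x \<in> trajectory G \<phi> F" and "y \<in> trajectory G \<phi> F" for x y
  proof -
    have "\<forall>\<^sub>F n in sequentially. {x, y} \<subseteq> traj_upto G \<phi> F n"
      using that by (intro finite_subset_incseq_Union incseq_traj_upto)
        (auto simp: trajectory_eq_Union)
    then obtain n where "x \<in> traj_upto G \<phi> F n" "y \<in> traj_upto G \<phi> F n"
      by (auto simp: eventually_sequentially)
    then show ?thesis
      using subgroup.m_closed[OF subgroup_traj_upto] by (auto simp: trajectory_eq_Union)
  qed
qed

lemma finite_traj_upto: "finite F \<Longrightarrow> finite (traj_upto G \<phi> F n)"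
  by (induction n) (simp_all only: traj_upto.simps finite_set_mult finite_imageI finite.intros)

lemma card_image_traj_upto:
  assumes "finite F"
  shows "card (\<phi> ` traj_upto G \<phi> F n) * card (kernel G G \<phi> \<inter> traj_upto G \<phi> F n)
    = card (traj_upto G \<phi> F n)"
proof (rule card_image_mult_card_fibre)
  show "subgroup (traj_upto G \<phi> F n) G" by (rule subgroup_traj_upto)
  show "finite (traj_upto G \<phi> F n)" using assms by (rule finite_traj_upto)
  show "\<phi> x = \<phi> y \<longleftrightarrow> x \<otimes> inv y \<in> kernel G G \<phi>"
    if "x \<in> traj_upto G \<phi> F n" and "y \<in> traj_upto G \<phi> F n" for x y
  proof (rule hom_eq_iff_kernel)
    show "x \<in> carrier G" by (rule subsetD[OF traj_upto_subset_carrier that(1)])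
    show "y \<in> carrier G" by (rule subsetD[OF traj_upto_subset_carrier that(2)])
  qed
qed

text \<open>For large \<open>n\<close>, passing from \<open>T\<^sub>n\<close> to \<open>\<phi>(T\<^sub>n)\<close> divides the size by \<open>|ker \<phi> \<inter> T|\<close>, and
  passing from \<open>\<phi>(T\<^sub>n)\<close> to \<open>T\<^sub>n\<^sub>+\<^sub>1\<close> multiplies it by the index of \<open>\<phi>(T)\<close> in \<open>T\<close>.\<close>

lemma eventually_card_traj_upto_Suc:
  assumes fin: "finite F" and kfin: "finite (kernel G G \<phi> \<inter> trajectory G \<phi> F)"
  shows "\<forall>\<^sub>F n in sequentially.
    card (traj_upto G \<phi> F (Suc n)) * card (kernel G G \<phi> \<inter> trajectory G \<phi> F)
    = card (cosets_in G (trajectory G \<phi> F) (\<phi> ` trajectory G \<phi> F)) * card (traj_upto G \<phi> F n)"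
proof -
  let ?T = "trajectory G \<phi> F" and ?t = "traj_upto G \<phi> F"
  let ?K = "kernel G G \<phi> \<inter> ?T" and ?c = "card (cosets_in G ?T (\<phi> ` ?T))"
  have "\<forall>\<^sub>F n in sequentially. \<phi> ` ?T \<inter> F \<subseteq> \<phi> ` ?t n"
    using incseq_traj_upto fin
    by (intro finite_subset_incseq_Union) (auto simp: trajectory_eq_Union mono_def image_mono)
  moreover have "\<forall>\<^sub>F n in sequentially. ?K \<subseteq> ?t n"
    using incseq_traj_upto kfin
    by (intro finite_subset_incseq_Union) (auto simp: trajectory_eq_Union)
  ultimately show ?thesis
  proof eventually_elim
    case (elim n)
    let ?H = "\<phi> ` ?t n"
    have H: "subgroup ?H G" and H': "subgroup (\<phi> ` ?T) G"
      using subgroup_img_is_subgroup subgroup_traj_upto subgroup_trajectory by auto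
    have sub: "?t n \<subseteq> ?T" by (auto simp: trajectory_eq_Union)
    have "card (cosets_in G (?t (Suc n)) ?H) * card (?H \<inter> F) = card F"
      unfolding traj_upto_Suc_left by (rule card_cosets_in_normal_mult(2)[OF H F fin])
    moreover have "?c * card (\<phi> ` ?T \<inter> F) = card F"
      using card_cosets_in_normal_mult(2)[OF H' F fin] trajectory_left by simp
    moreover have "?H \<inter> F = \<phi> ` ?T \<inter> F" using elim(1) sub by auto
    moreover have "card F \<noteq> 0"
      using fin subgroup.one_closed[OF normal_imp_subgroup[OF F]] by auto
    ultimately have idx: "card (cosets_in G (?t (Suc n)) ?H) = ?c"
      by (metis mult_cancel2 mult_0_right)
    have "?H \<subseteq> ?t (Suc n)"
      unfolding traj_upto_Suc_left
    proof
      fix x assume x: "x \<in> ?H"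
      then have "x = \<one> \<otimes> x" using subgroup.mem_carrier[OF H] by simp
      then show "x \<in> F <#> ?H"
        using x subgroup.one_closed[OF normal_imp_subgroup[OF F]]
        unfolding set_mult_def by blast
    qed
    then have "?c * card ?H = card (?t (Suc n))"
      using card_cosets_in[OF subgroup_traj_upto H, of "Suc n"] idx by simp
    moreover have "kernel G G \<phi> \<inter> ?t n = ?K" using elim(2) sub by auto
    then have "card ?H * card ?K = card (?t n)"
      using card_image_traj_upto[OF fin, of n] by simp
    ultimately show ?case by (metis mult.assoc)
  qed
qed

end

section \<open>The entropy formula\<close>

theorem theorem2p2:
  fixes G :: "('a, 'b) monoid_scheme" and \<phi> :: "'a \<Rightarrow> 'a" and F :: "'a set"
  assumes "locally_finite_group G"
    and "\<phi> \<in> hom G G"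
    and "F \<lhd> G" and "finite F"
    and "finite (kernel G G \<phi> \<inter> trajectory G \<phi> F)"
  shows "convergent (\<lambda>n. ln (real (card (traj_upto G \<phi> F n))) / real n)
    \<and> finite (cosets_in G (trajectory G \<phi> F) (\<phi> ` trajectory G \<phi> F))
    \<and> alg_entropy G \<phi> F =
        ln (real (card (cosets_in G (trajectory G \<phi> F) (\<phi> ` trajectory G \<phi> F))))
        - ln (real (card (kernel G G \<phi> \<inter> trajectory G \<phi> F)))"
proof -
  have G: "group G" using assms(1) by (simp add: locally_finite_group_def)
  interpret group G by (rule G)
  interpret group_hom G G \<phi> using assms(2) by unfold_locales
  let ?T = "trajectory G \<phi> F" and ?t = "traj_upto G \<phi> F"
  let ?k = "card (kernel G G \<phi> \<inter> ?T)" and ?c = "card (cosets_in G ?T (\<phi> ` ?T))"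
  note traj = G assms(2,3)
  have H: "subgroup (\<phi> ` ?T) G"
    using subgroup_img_is_subgroup subgroup_trajectory[OF traj] .
  have fin: "finite (cosets_in G ?T (\<phi> ` ?T))"
    using card_cosets_in_normal_mult(1)[OF H assms(3,4)] trajectory_left[OF traj] by simp
  have "?c * card (\<phi> ` ?T \<inter> F) = card F"
    using card_cosets_in_normal_mult(2)[OF H assms(3,4)] trajectory_left[OF traj] by simp
  moreover have "card F > 0"
    using assms(4) subgroup.one_closed[OF normal_imp_subgroup[OF assms(3)]]
    by (auto simp: card_gt_0_iff)
  ultimately have c: "?c > 0" by (metis gr0I mult_0 less_irrefl)
  have "\<one>\<^bsub>G\<^esub> \<in> kernel G G \<phi> \<inter> ?T"
    using subgroup.one_closed[OF subgroup_trajectory[OF traj]] by (simp add: kernel_def)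
  then have k: "?k > 0" using assms(5) by (auto simp: card_gt_0_iff)
  have t: "card (?t n) > 0" for n
    using finite_traj_upto[OF traj assms(4)] subgroup.one_closed[OF subgroup_traj_upto[OF traj]]
    by (metis card_gt_0_iff empty_iff)
  have "\<forall>\<^sub>F n in sequentially.
      ln (real (card (?t (Suc n)))) = ln (real (card (?t n))) + (ln (real ?c) - ln (real ?k))"
    using eventually_card_traj_upto_Suc[OF traj assms(4,5)]
  proof eventually_elim
    case (elim n)
    then have "real (card (?t (Suc n))) * real ?k = real ?c * real (card (?t n))"
      by (metis of_nat_mult)
    then have "ln (real (card (?t (Suc n))) * real ?k) = ln (real ?c * real (card (?t n)))"
      by (rule arg_cong)
    then show ?case
      using t[of n] t[of "Suc n"] c k
      by (simp only: ln_mult_pos of_nat_0_less_iff)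
  qed
  then have "(\<lambda>n. ln (real (card (?t n))) / real n) \<longlonglongrightarrow> ln (real ?c) - ln (real ?k)"
    by (rule tendsto_div_of_eventually_const_diff)
  then show ?thesis
    using fin unfolding alg_entropy_def by (auto simp: convergent_def dest: limI)
qed

end
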